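(* Let $L>0$, let $\nu>0$, and let $f_1,K$ be real constants such that $a:=\frac{1}{2\nu^2}(K-f_1)<0$. The general real solution on $[0,L]$ of the ordinary differential equation $$u_1\dot u_1 = f_1 - K + \nu\,\ddot u_1$$ is $$u_1(s) = -2\nu\,(-a)^{1/3}\,\frac{c_1\,\mathrm{Ai}'(t)+c_2\,\mathrm{Bi}'(t)}{c_1\,\mathrm{Ai}(t)+c_2\,\mathrm{Bi}(t)},\qquad t=t(s)=-\frac{as+b}{(-a)^{2/3}},\qquad b=\frac{c}{2\nu^2},$$ where $c,c_1,c_2$ are real constants. That is, a twice differentiable function $u_1:[0,L]\to\mathbb{R}$ satisfies the equation if and only if there exist $c,c_1,c_2\in\mathbb{R}$, with $c_1\,\mathrm{Ai}(t(s))+c_2\,\mathrm{Bi}(t(s))\neq 0$ for all $s\in[0,L]$, such that $u_1$ is given by this formula. Here $c$ is the constant of integration in the once-integrated (Riccati) equation $\dot u_1=\frac{1}{2\nu}u_1^2+\frac1\nu(K-f_1)s+\frac{c}{\nu}$.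
   Context: Dots denote derivatives with respect to $s$. $\mathrm{Ai}$ and $\mathrm{Bi}$ are the standard Airy functions, linearly independent real solutions of $y''(t)-t\,y(t)=0$, and $\mathrm{Ai}',\mathrm{Bi}'$ are their derivatives. Origin of the equation: it is the first component of the two-dimensional steady Navier-Stokes equations along a streamline parameterized by $x=s$, $y=\phi_2(s)$, for a compressible fluid. In it $u_1$ is the first velocity component along the streamline, $f_1$ the constant first component of the body force, $\nu=\mu/\rho$ the kinematic viscosity (constant along the streamline), and $K=\dot q/\rho$ (assumed constant along the streamline), with $q$ the pressure along the streamline and $\rho$ the density. *)

theory Defs
  imports "HOL-Analysis.Analysis"
begin

definition airy_solution :: "real \<Rightarrow> real \<Rightarrow> (real \<Rightarrow> real) \<Rightarrow> bool" where
  "airy_solution y0 y1 y \<longleftrightarrow>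
     y 0 = y0 \<and> (\<exists>y'. y' 0 = y1 \<and>
       (\<forall>t. (y has_real_derivative y' t) (at t)) \<and>
       (\<forall>t. (y' has_real_derivative t * y t) (at t)))"

text \<open>The initial values are the standard normalisation of the Airy functions (DLMF 9.2.3-9.2.6);
  existence and uniqueness of the solutions are shown below.\<close>

definition airy_Ai :: "real \<Rightarrow> real" where
  "airy_Ai = (THE y. airy_solution
     (1 / (3 powr (2/3) * Gamma (2/3))) (- 1 / (3 powr (1/3) * Gamma (1/3))) y)"

definition airy_Bi :: "real \<Rightarrow> real" where
  "airy_Bi = (THE y. airy_solution
     (1 / (3 powr (1/6) * Gamma (2/3))) (3 powr (1/6) / Gamma (1/3)) y)"

definition airy_arg :: "real \<Rightarrow> real \<Rightarrow> real \<Rightarrow> real" where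
  "airy_arg a b s = - ((a * s + b) / (- a) powr (2/3))"

definition airy_comb :: "real \<Rightarrow> real \<Rightarrow> real \<Rightarrow> real" where
  "airy_comb c1 c2 t = c1 * airy_Ai t + c2 * airy_Bi t"

definition airy_comb' :: "real \<Rightarrow> real \<Rightarrow> real \<Rightarrow> real" where
  "airy_comb' c1 c2 t = c1 * deriv airy_Ai t + c2 * deriv airy_Bi t"

definition velocity_formula_on ::
    "real set \<Rightarrow> real \<Rightarrow> real \<Rightarrow> real \<Rightarrow> real \<Rightarrow> real \<Rightarrow> (real \<Rightarrow> real) \<Rightarrow> bool" where
  "velocity_formula_on S \<nu> a c c1 c2 u \<longleftrightarrow>
     (\<forall>s\<in>S. let b = c / (2 * \<nu>\<^sup>2); t = airy_arg a b s in
        airy_comb c1 c2 t \<noteq> 0 \<and>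
        u s = - 2 * \<nu> * (- a) powr (1/3) * (airy_comb' c1 c2 t / airy_comb c1 c2 t))"


subsection \<open>Well-definedness of the Airy functions\<close>

lemma airy_solution_zero:
  fixes w w' :: "real \<Rightarrow> real"
  assumes w: "\<And>t. (w has_real_derivative w' t) (at t)"
    and w': "\<And>t. (w' has_real_derivative t * w t) (at t)"
    and init: "w 0 = 0" "w' 0 = 0"
  shows "w t = 0"
proof -
  define k where "k = 1 + \<bar>t\<bar>"
  define E where "E x = (w x)\<^sup>2 + (w' x)\<^sup>2" for x
  define E' where "E' x = 2 * w x * w' x * (1 + x)" for x
  have E: "(E has_real_derivative E' x) (at x)" for x
    unfolding E_def E'_def
    by (auto intro!: derivative_eq_intros w w' simp: algebra_simps)
  have bound: "\<bar>E' x\<bar> \<le> k * E x" if "\<bar>x\<bar> \<le> \<bar>t\<bar>" for x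
  proof -
    have "0 \<le> (\<bar>w x\<bar> - \<bar>w' x\<bar>)\<^sup>2"
      by simp
    then have "\<bar>2 * w x * w' x\<bar> \<le> E x"
      by (simp add: E_def power2_diff abs_mult)
    moreover have "\<bar>1 + x\<bar> \<le> k"
      using that by (simp add: k_def)
    ultimately have "\<bar>2 * w x * w' x\<bar> * \<bar>1 + x\<bar> \<le> E x * k"
      by (intro mult_mono) (auto simp: E_def)
    then show ?thesis
      by (simp add: E'_def abs_mult mult.commute)
  qed
  have "E t \<le> 0"
  proof (cases "0 \<le> t")
    case True
    have "E t * exp (- k * t) \<le> E 0 * exp (- k * 0)"
    proof (rule DERIV_nonpos_imp_nonincreasing[OF True])
      fix x assume "0 \<le> x" "x \<le> t"
      then have "E' x \<le> k * E x"
        using bound[of x] by auto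
      then have "(E' x - k * E x) * exp (- k * x) \<le> 0"
        by (simp add: mult_le_0_iff)
      moreover have "((\<lambda>x. E x * exp (- k * x)) has_real_derivative
          (E' x - k * E x) * exp (- k * x)) (at x)"
        by (auto intro!: derivative_eq_intros E simp: algebra_simps)
      ultimately show "\<exists>y. ((\<lambda>x. E x * exp (- k * x)) has_real_derivative y) (at x) \<and> y \<le> 0"
        by blast
    qed
    then show ?thesis
      by (simp add: E_def init mult_le_0_iff)
  next
    case False
    then have t: "t \<le> 0" by simp
    have "E t * exp (k * t) \<le> E 0 * exp (k * 0)"
    proof (rule DERIV_nonneg_imp_nondecreasing[OF t])
      fix x assume "t \<le> x" "x \<le> 0"
      then have "- E' x \<le> k * E x"
        using bound[of x] by auto
      then have "0 \<le> (E' x + k * E x) * exp (k * x)"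
        by simp
      moreover have "((\<lambda>x. E x * exp (k * x)) has_real_derivative
          (E' x + k * E x) * exp (k * x)) (at x)"
        by (auto intro!: derivative_eq_intros E simp: algebra_simps)
      ultimately show "\<exists>y. ((\<lambda>x. E x * exp (k * x)) has_real_derivative y) (at x) \<and> 0 \<le> y"
        by blast
    qed
    then show ?thesis
      by (simp add: E_def init mult_le_0_iff)
  qed
  then show ?thesis
    by (simp add: E_def sum_power2_le_zero_iff)
qed

lemma airy_solution_unique:
  assumes "airy_solution y0 y1 y" "airy_solution y0 y1 z"
  shows "y = z"
proof
  fix t
  obtain y' where y': "y' 0 = y1" "\<And>t. (y has_real_derivative y' t) (at t)"
      "\<And>t. (y' has_real_derivative t * y t) (at t)"
    using assms(1) by (auto simp: airy_solution_def)
  obtain z' where z': "z' 0 = y1" "\<And>t. (z has_real_derivative z' t) (at t)"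
      "\<And>t. (z' has_real_derivative t * z t) (at t)"
    using assms(2) by (auto simp: airy_solution_def)
  have "y t - z t = 0"
  proof (rule airy_solution_zero[where w = "\<lambda>t. y t - z t" and w' = "\<lambda>t. y' t - z' t"])
    show "((\<lambda>t. y t - z t) has_real_derivative y' t - z' t) (at t)" for t
      by (intro derivative_intros y' z')
    show "((\<lambda>t. y' t - z' t) has_real_derivative t * (y t - z t)) (at t)" for t
      by (auto intro!: derivative_eq_intros y' z' simp: algebra_simps)
  qed (use assms y' z' in \<open>auto simp: airy_solution_def\<close>)
  then show "y t = z t" by simp
qed

fun airy_coeff :: "real \<Rightarrow> real \<Rightarrow> nat \<Rightarrow> real" where
  "airy_coeff y0 y1 0 = y0"
| "airy_coeff y0 y1 (Suc 0) = y1"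
| "airy_coeff y0 y1 (Suc (Suc 0)) = 0"
| "airy_coeff y0 y1 (Suc (Suc (Suc n))) = airy_coeff y0 y1 n / (real (n + 2) * real (n + 3))"

lemma summable_airy_coeff: "summable (\<lambda>n. airy_coeff y0 y1 n * x ^ n)"
proof -
  define R where "R = \<bar>x\<bar> + 1"
  have R: "0 \<le> \<bar>x\<bar>" "\<bar>x\<bar> < R" by (auto simp: R_def)
  define N where "N = nat \<lceil>R ^ 3\<rceil>"
  define M where "M = Max ((\<lambda>n. norm (airy_coeff y0 y1 n) * R ^ n) ` {..N + 3})"
  have "norm (airy_coeff y0 y1 n) * R ^ n \<le> M" for n
  proof (induction n rule: less_induct)
    case (less n)
    show ?case
    proof (cases "n \<le> N + 3")
      case True
      then show ?thesis
        unfolding M_def by (intro Max_ge) auto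
    next
      case False
      then obtain m where n: "n = Suc (Suc (Suc m))" and m: "N \<le> m"
        by (metis One_nat_def Suc_le_D add_le_cancel_right not_less_eq_eq numeral_3_eq_3 add_Suc_right
            Nat.add_0_right nat_le_linear Suc_le_mono)
      have "R ^ 3 \<le> real m"
        using m unfolding N_def by linarith
      also have "real m \<le> real (m + 2) * real (m + 3)"
        by (simp add: algebra_simps)
      finally have q: "R ^ 3 / (real (m + 2) * real (m + 3)) \<le> 1"
        by (simp add: divide_le_eq)
      have "norm (airy_coeff y0 y1 n) * R ^ n =
          norm (airy_coeff y0 y1 m) * R ^ m * (R ^ 3 / (real (m + 2) * real (m + 3)))"
        by (simp add: n power3_eq_cube abs_divide abs_mult)
      also have "\<dots> \<le> norm (airy_coeff y0 y1 m) * R ^ m * 1"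
        using q R by (intro mult_left_mono) auto
      also have "\<dots> \<le> M"
        using less.IH[of m] n by simp
      finally show ?thesis .
    qed
  qed
  then have "summable (\<lambda>n. norm (airy_coeff y0 y1 n) * \<bar>x\<bar> ^ n)"
    using R by (intro Abel_lemma) auto
  then show ?thesis
    by (intro summable_norm_cancel[where f = "\<lambda>n. airy_coeff y0 y1 n * x ^ n"])
      (simp add: abs_mult power_abs)
qed

lemma airy_solution_exists: "\<exists>y. airy_solution y0 y1 y"
proof -
  define c where "c = airy_coeff y0 y1"
  have sm: "summable (\<lambda>n. c n * x ^ n)" for x
    unfolding c_def by (rule summable_airy_coeff)
  have sm1: "summable (\<lambda>n. diffs c n * x ^ n)" for x
    by (rule termdiff_converges_all) (rule sm)
  have sm2: "summable (\<lambda>n. diffs (diffs c) n * x ^ n)" for x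
    by (rule termdiff_converges_all) (rule sm1)
  define y where "y x = (\<Sum>n. c n * x ^ n)" for x
  define y' where "y' x = (\<Sum>n. diffs c n * x ^ n)" for x
  have d1: "(y has_real_derivative y' x) (at x)" for x
    unfolding y_def y'_def by (rule termdiffs_strong_converges_everywhere) (rule sm)
  have d2: "(y' has_real_derivative (\<Sum>n. diffs (diffs c) n * x ^ n)) (at x)" for x
    unfolding y'_def by (rule termdiffs_strong_converges_everywhere) (rule sm1)
  have dd: "(\<Sum>n. diffs (diffs c) n * x ^ n) = x * y x" for x
  proof -
    have shift: "diffs (diffs c) (Suc n) = c n" for n
      by (simp add: diffs_def c_def divide_simps)
    have "(\<Sum>n. diffs (diffs c) n * x ^ n)
        = diffs (diffs c) 0 + (\<Sum>n. diffs (diffs c) (Suc n) * x ^ Suc n)"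
      using suminf_split_head[OF sm2[of x]] by simp
    also have "\<dots> = (\<Sum>n. x * (c n * x ^ n))"
      by (simp add: shift) (simp add: diffs_def c_def mult_ac numeral_2_eq_2)
    also have "\<dots> = x * y x"
      unfolding y_def by (rule suminf_mult) (rule sm)
    finally show ?thesis .
  qed
  have "y 0 = y0" "y' 0 = y1"
    by (simp_all add: y_def y'_def diffs_def c_def)
  then have "airy_solution y0 y1 y"
    using d1 d2 unfolding airy_solution_def dd by blast
  then show ?thesis by blast
qed

lemma airy_solution_The: "airy_solution y0 y1 (THE y. airy_solution y0 y1 y)"
  using airy_solution_exists airy_solution_unique by (metis theI)

lemma airy_Ai_solution:
  "airy_solution (1 / (3 powr (2/3) * Gamma (2/3))) (- 1 / (3 powr (1/3) * Gamma (1/3))) airy_Ai"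
  unfolding airy_Ai_def by (rule airy_solution_The)

lemma airy_Bi_solution:
  "airy_solution (1 / (3 powr (1/6) * Gamma (2/3))) (3 powr (1/6) / Gamma (1/3)) airy_Bi"
  unfolding airy_Bi_def by (rule airy_solution_The)

end

theory Submission
  imports Defs
begin

text \<open>
  The equation is an exact derivative: it says that
  \<open>\<nu> u' - u\<^sup>2 / 2 - (K - f1) s\<close> is constant on the interval, and calling the constant \<open>c\<close>
  gives the Riccati equation \<open>u' = u\<^sup>2 / (2 \<nu>) + 2 \<nu> (a s + b)\<close> with \<open>b = c / (2 \<nu>\<^sup>2)\<close>
  (\<open>burgers_iff_riccati\<close>). The substitution \<open>u = - 2 \<nu> W' / W\<close> linearises it to
  \<open>W'' = - (a s + b) W\<close>, and the affine change of variable \<open>t = airy_arg a b s\<close>, whose slope is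
  \<open>(- a) powr (1/3)\<close>, turns this into Airy's equation.

  That the formula solves the Riccati equation is then a computation (\<open>linear_to_riccati\<close>). For the
  converse, a combination of \<open>Ai\<close> and \<open>Bi\<close> is fitted to the initial values \<open>W = 1\<close>,
  \<open>- 2 \<nu> W' = u\<close> at the left endpoint, which is possible since the Wronskian of \<open>Ai\<close> and \<open>Bi\<close>
  has no zero (\<open>airy_comb_initial_values\<close>). The delicate point is that this \<open>W\<close> has no zero on the
  whole interval, so that the quotient makes sense. It holds because the given \<open>u\<close> is finite
  everywhere: the defect \<open>W' + u W / (2 \<nu>)\<close> satisfies a homogeneous linear first-order equation
  and vanishes at the left endpoint, hence vanishes identically; so \<open>W' = - (u / (2 \<nu>)) W\<close>, and
  \<open>W\<close> is an exponential (\<open>riccati_to_linear\<close>).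
\<close>


section \<open>Calculus on a closed interval\<close>

lemma real_derivative_unique_Icc:
  fixes f :: "real \<Rightarrow> real"
  assumes "l < r" "x \<in> {l..r}"
    and "(f has_real_derivative d) (at x within {l..r})"
    and "(f has_real_derivative e) (at x within {l..r})"
  shows "d = e"
  using vector_derivative_unique_within_closed_interval[of l r x f d e] assms
  by (simp add: has_real_derivative_iff_has_vector_derivative)

lemma zero_derivative_constant_Icc:
  fixes f :: "real \<Rightarrow> real"
  assumes "\<And>x. x \<in> {l..r} \<Longrightarrow> (f has_real_derivative 0) (at x within {l..r})"
    and "x \<in> {l..r}"
  shows "f x = f l"
proof -
  obtain k where "\<And>x. x \<in> {l..r} \<Longrightarrow> f x = k"
    using has_field_derivative_zero_constant[of "{l..r}" f] assms(1) by auto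
  then show ?thesis using assms(2) by auto
qed

text \<open>The solution of a homogeneous linear equation is a multiple of an exponential, hence either
  vanishes identically or has no zero: the first is used for the defect, the second for \<open>W\<close>.\<close>

lemma linear_ode_eq_exp:
  fixes y p :: "real \<Rightarrow> real"
  assumes "continuous_on {l..r} p"
    and y: "\<And>s. s \<in> {l..r} \<Longrightarrow> (y has_real_derivative p s * y s) (at s within {l..r})"
  shows "\<exists>P. \<forall>s\<in>{l..r}. y s = y l * exp (P s)"
proof -
  obtain P where "\<And>s. s \<in> {l..r} \<Longrightarrow> (P has_vector_derivative p s) (at s within {l..r})"
    using antiderivative_continuous[OF assms(1)] by blast
  then have P: "(P has_real_derivative p s) (at s within {l..r})" if "s \<in> {l..r}" for s
    using that by (simp add: has_real_derivative_iff_has_vector_derivative)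
  have const: "y s * exp (- P s) = y l * exp (- P l)" if "s \<in> {l..r}" for s
  proof (rule zero_derivative_constant_Icc[OF _ that])
    fix x assume "x \<in> {l..r}"
    then show "((\<lambda>s. y s * exp (- P s)) has_real_derivative 0) (at x within {l..r})"
      by (auto intro!: derivative_eq_intros y P simp: algebra_simps)
  qed
  have "\<forall>s\<in>{l..r}. y s = y l * exp (P s - P l)"
  proof
    fix s assume "s \<in> {l..r}"
    from const[OF this] show "y s = y l * exp (P s - P l)"
      by (simp add: exp_diff exp_minus field_simps)
  qed
  then show ?thesis by (rule exI[of _ "\<lambda>s. P s - P l"])
qed


section \<open>Riccati equations and second-order linear equations\<close>

lemma linear_to_riccati:
  fixes W W' q :: "real \<Rightarrow> real"
  assumes "\<nu> \<noteq> 0" "W s \<noteq> 0"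
    and "(W has_real_derivative W' s) (at s within S)"
    and "(W' has_real_derivative - q s * W s) (at s within S)"
  shows "((\<lambda>s. - 2 * \<nu> * (W' s / W s)) has_real_derivative
            1 / (2 * \<nu>) * (- 2 * \<nu> * (W' s / W s))\<^sup>2 + 2 * \<nu> * q s) (at s within S)"
  by (rule derivative_eq_intros assms refl)+
    (use assms(1,2) in \<open>simp add: field_simps power2_eq_square\<close>)

text \<open>Matching initial values at the left endpoint force \<open>W\<close> to stay away from zero as long as
  \<open>u\<close> exists: the zeros of \<open>W\<close> are the blow-up points of the Riccati solution.\<close>

lemma riccati_to_linear:
  fixes u W W' q :: "real \<Rightarrow> real"
  assumes "\<nu> \<noteq> 0"
    and u: "\<And>s. s \<in> {l..r} \<Longrightarrow>
      (u has_real_derivative 1 / (2 * \<nu>) * (u s)\<^sup>2 + 2 * \<nu> * q s) (at s within {l..r})"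
    and W: "\<And>s. s \<in> {l..r} \<Longrightarrow> (W has_real_derivative W' s) (at s within {l..r})"
    and W': "\<And>s. s \<in> {l..r} \<Longrightarrow> (W' has_real_derivative - q s * W s) (at s within {l..r})"
    and init: "W l \<noteq> 0" "u l * W l = - 2 * \<nu> * W' l"
    and s: "s \<in> {l..r}"
  shows "W s \<noteq> 0 \<and> u s = - 2 * \<nu> * (W' s / W s)"
proof -
  define D where "D s = W' s + 1 / (2 * \<nu>) * (u s * W s)" for s
  have "continuous_on {l..r} u"
    using u by (intro DERIV_continuous_on) auto
  then have cont_p: "continuous_on {l..r} (\<lambda>s. u s / (2 * \<nu>))"
    using assms(1) by (auto intro!: continuous_intros)
  have D': "(D has_real_derivative u s / (2 * \<nu>) * D s) (at s within {l..r})" if "s \<in> {l..r}" for s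
    using DERIV_add[OF W'[OF that] DERIV_cmult[OF DERIV_mult[OF u[OF that] W[OF that]],
        of "1 / (2 * \<nu>)"]]
    unfolding D_def by (rule DERIV_cong) (use assms(1) in \<open>simp add: field_simps power2_eq_square\<close>)
  obtain P where P: "\<forall>s\<in>{l..r}. D s = D l * exp (P s)"
    using linear_ode_eq_exp[OF cont_p D'] ..
  have "D l = 0"
    using init assms(1) by (simp add: D_def field_simps)
  have W'_eq: "W' s = - (u s / (2 * \<nu>)) * W s" if "s \<in> {l..r}" for s
    using bspec[OF P that] \<open>D l = 0\<close> by (simp add: D_def)
  have W_ode: "(W has_real_derivative - (u s / (2 * \<nu>)) * W s) (at s within {l..r})"
    if "s \<in> {l..r}" for s
    using W[OF that] W'_eq[OF that] by simp
  obtain Q where Q: "\<forall>s\<in>{l..r}. W s = W l * exp (Q s)"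
    using linear_ode_eq_exp[OF continuous_on_minus[OF cont_p] W_ode] ..
  have "W s \<noteq> 0"
    using bspec[OF Q s] init(1) by simp
  then show ?thesis
    using W'_eq[OF s] assms(1) by simp
qed


section \<open>Airy functions\<close>

lemma airy_solution_derivatives:
  assumes "airy_solution y0 y1 y"
  shows "y 0 = y0" "deriv y 0 = y1"
    and "(y has_real_derivative deriv y t) (at t)"
    and "(deriv y has_real_derivative t * y t) (at t)"
proof -
  obtain y' where y': "y 0 = y0" "y' 0 = y1" "\<And>t. (y has_real_derivative y' t) (at t)"
      "\<And>t. (y' has_real_derivative t * y t) (at t)"
    using assms by (auto simp: airy_solution_def)
  have "deriv y = y'"
    using y'(3) by (auto intro: DERIV_imp_deriv)
  with y' show "y 0 = y0" "deriv y 0 = y1"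
    "(y has_real_derivative deriv y t) (at t)" "(deriv y has_real_derivative t * y t) (at t)"
    by auto
qed

lemmas airy_Ai_facts = airy_solution_derivatives[OF airy_Ai_solution]
  and airy_Bi_facts = airy_solution_derivatives[OF airy_Bi_solution]

lemma airy_comb_has_derivative:
  "(airy_comb c1 c2 has_real_derivative airy_comb' c1 c2 t) (at t)"
  "(airy_comb' c1 c2 has_real_derivative t * airy_comb c1 c2 t) (at t)"
  unfolding airy_comb_def airy_comb'_def
  by (auto intro!: derivative_eq_intros airy_Ai_facts(3,4) airy_Bi_facts(3,4) simp: algebra_simps)

text \<open>The Wronskian is constant, and at \<open>0\<close> both of its terms are positive because \<open>Ai' 0\<close> is the
  only negative one of the four initial values.\<close>

lemma airy_wronskian_pos:
  "airy_Ai t * deriv airy_Bi t - deriv airy_Ai t * airy_Bi t > 0"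
proof -
  define w where "w t = airy_Ai t * deriv airy_Bi t - deriv airy_Ai t * airy_Bi t" for t
  have "(w has_real_derivative 0) (at t)" for t
    unfolding w_def
    by (auto intro!: derivative_eq_intros airy_Ai_facts(3,4) airy_Bi_facts(3,4))
  then have "w t = w 0"
    by (simp add: DERIV_isconst_all)
  also have "w 0 > 0"
  proof -
    have pos: "Gamma (1/3 :: real) > 0" "Gamma (2/3 :: real) > 0"
      by (auto intro: Gamma_real_pos)
    have "airy_Ai 0 > 0" "deriv airy_Ai 0 < 0" "airy_Bi 0 > 0" "deriv airy_Bi 0 > 0"
      unfolding airy_Ai_facts(1,2) airy_Bi_facts(1,2) using pos by simp_all
    then have "airy_Ai 0 * deriv airy_Bi 0 > 0" "deriv airy_Ai 0 * airy_Bi 0 < 0"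
      by (simp_all add: mult_neg_pos)
    then show ?thesis
      by (simp add: w_def)
  qed
  finally show ?thesis
    by (simp add: w_def)
qed

lemma airy_comb_initial_values:
  obtains c1 c2 where "airy_comb c1 c2 t = p" "airy_comb' c1 c2 t = q"
proof -
  define w where "w = airy_Ai t * deriv airy_Bi t - deriv airy_Ai t * airy_Bi t"
  have w: "w \<noteq> 0"
    using airy_wronskian_pos[of t] by (simp add: w_def)
  \<comment> \<open>Cramer's rule\<close>
  define c1 where "c1 = (p * deriv airy_Bi t - q * airy_Bi t) / w"
  define c2 where "c2 = (q * airy_Ai t - p * deriv airy_Ai t) / w"
  have "airy_comb c1 c2 t = p * w / w" "airy_comb' c1 c2 t = q * w / w"
    unfolding airy_comb_def airy_comb'_def c1_def c2_def
    by (simp_all add: w_def add_divide_distrib[symmetric] algebra_simps)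
  then show thesis
    using w that by simp
qed

text \<open>In the variable \<open>s\<close> the Airy equation has the coefficient \<open>- (a s + b)\<close>: the slope \<open>k\<close> of
  \<open>airy_arg\<close> satisfies \<open>k\<^sup>2 t = - (a s + b)\<close>, which is the reason for the scaling.\<close>

lemma airy_comb_airy_arg_has_derivative:
  assumes "a < 0"
  defines "k \<equiv> (- a) powr (1/3)"
  shows "((\<lambda>s. airy_comb c1 c2 (airy_arg a b s)) has_real_derivative
            k * airy_comb' c1 c2 (airy_arg a b s)) (at s within S)"
    and "((\<lambda>s. k * airy_comb' c1 c2 (airy_arg a b s)) has_real_derivative
            - (a * s + b) * airy_comb c1 c2 (airy_arg a b s)) (at s within S)"
proof -
  have k: "k > 0"
    using assms by simp
  have k2: "(- a) powr (2/3) = k ^ 2"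
    using k by (simp add: k_def powr_powr flip: powr_numeral)
  have k3: "- a = k ^ 3"
    using k assms(1) by (simp add: k_def powr_powr flip: powr_numeral)
  have arg: "airy_arg a b = (\<lambda>s. - ((a * s + b) / k\<^sup>2))"
    by (auto simp: airy_arg_def k2)
  have slope: "(airy_arg a b has_real_derivative k) (at s within S)"
    unfolding arg using k k3
    by (auto intro!: derivative_eq_intros simp: field_simps power2_eq_square power3_eq_cube)
  show "((\<lambda>s. airy_comb c1 c2 (airy_arg a b s)) has_real_derivative
      k * airy_comb' c1 c2 (airy_arg a b s)) (at s within S)"
    using DERIV_chain2[OF airy_comb_has_derivative(1) slope] by (simp add: mult.commute)
  have "k * airy_arg a b s * k = - (a * s + b)"
    using k by (simp add: arg power2_eq_square)
  then have "k * (airy_arg a b s * airy_comb c1 c2 (airy_arg a b s) * k)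
      = - (a * s + b) * airy_comb c1 c2 (airy_arg a b s)"
    by (metis mult.assoc mult.commute)
  then show "((\<lambda>s. k * airy_comb' c1 c2 (airy_arg a b s)) has_real_derivative
      - (a * s + b) * airy_comb c1 c2 (airy_arg a b s)) (at s within S)"
    using DERIV_cmult[OF DERIV_chain2[OF airy_comb_has_derivative(2) slope], of k] by metis
qed


section \<open>The general solution\<close>

lemma burgers_iff_riccati:
  fixes u du ddu :: "real \<Rightarrow> real"
  assumes "l < r" and "\<nu> \<noteq> 0"
    and u: "\<And>s. s \<in> {l..r} \<Longrightarrow> (u has_real_derivative du s) (at s within {l..r})"
    and du: "\<And>s. s \<in> {l..r} \<Longrightarrow> (du has_real_derivative ddu s) (at s within {l..r})"
  shows "(\<forall>s\<in>{l..r}. u s * du s = - d + \<nu> * ddu s) \<longleftrightarrow>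
    (\<exists>c. \<forall>s\<in>{l..r}. du s = 1 / (2 * \<nu>) * (u s)\<^sup>2 + 1 / \<nu> * d * s + c / \<nu>)"
proof -
  define F where "F s = \<nu> * du s - (u s)\<^sup>2 / 2 - d * s" for s
  have F: "(F has_real_derivative \<nu> * ddu s - u s * du s - d) (at s within {l..r})"
    if "s \<in> {l..r}" for s
    unfolding F_def using that by (auto intro!: derivative_eq_intros u du)
  have "(\<forall>s\<in>{l..r}. u s * du s = - d + \<nu> * ddu s) \<longleftrightarrow> (\<exists>c. \<forall>s\<in>{l..r}. F s = c)"
  proof
    assume eq: "\<forall>s\<in>{l..r}. u s * du s = - d + \<nu> * ddu s"
    have "(F has_real_derivative 0) (at s within {l..r})" if "s \<in> {l..r}" for s
      using F[OF that] eq that by simp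
    then show "\<exists>c. \<forall>s\<in>{l..r}. F s = c"
      using zero_derivative_constant_Icc[of l r F] by blast
  next
    assume "\<exists>c. \<forall>s\<in>{l..r}. F s = c"
    then obtain c where c: "\<And>s. s \<in> {l..r} \<Longrightarrow> F s = c" by blast
    show "\<forall>s\<in>{l..r}. u s * du s = - d + \<nu> * ddu s"
    proof
      fix s assume s: "s \<in> {l..r}"
      have "(F has_real_derivative 0) (at s within {l..r})"
        using has_field_derivative_transform_within[of "\<lambda>_. c" 0 s "{l..r}" 1 F] s c by simp
      from real_derivative_unique_Icc[OF assms(1) s F[OF s] this]
      show "u s * du s = - d + \<nu> * ddu s" by simp
    qed
  qed
  moreover have "F s = c \<longleftrightarrow> du s = 1 / (2 * \<nu>) * (u s)\<^sup>2 + 1 / \<nu> * d * s + c / \<nu>" for s c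
    using assms(2) by (auto simp: F_def field_simps)
  ultimately show ?thesis by simp
qed

lemma riccati_iff_velocity_formula:
  fixes u du :: "real \<Rightarrow> real"
  assumes "l < r" and "\<nu> \<noteq> 0" and "a < 0"
    and u: "\<And>s. s \<in> {l..r} \<Longrightarrow> (u has_real_derivative du s) (at s within {l..r})"
  shows "(\<forall>s\<in>{l..r}. du s = 1 / (2 * \<nu>) * (u s)\<^sup>2 + 2 * \<nu> * (a * s + c / (2 * \<nu>\<^sup>2))) \<longleftrightarrow>
    (\<exists>c1 c2. velocity_formula_on {l..r} \<nu> a c c1 c2 u)"
proof -
  define b where "b = c / (2 * \<nu>\<^sup>2)"
  define k where "k = (- a) powr (1/3)"
  have k: "k > 0"
    using assms(3) by (simp add: k_def)
  define W where "W c1 c2 s = airy_comb c1 c2 (airy_arg a b s)" for c1 c2 s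
  define W' where "W' c1 c2 s = k * airy_comb' c1 c2 (airy_arg a b s)" for c1 c2 s
  have W: "(W c1 c2 has_real_derivative W' c1 c2 s) (at s within S)"
    and W': "(W' c1 c2 has_real_derivative - (a * s + b) * W c1 c2 s) (at s within S)"
    for c1 c2 s S
    using airy_comb_airy_arg_has_derivative[OF assms(3), of c1 c2 b s S]
    by (simp_all add: W_def[abs_def] W'_def[abs_def] k_def)
  have formula: "velocity_formula_on {l..r} \<nu> a c c1 c2 u \<longleftrightarrow>
      (\<forall>s\<in>{l..r}. W c1 c2 s \<noteq> 0 \<and> u s = - 2 * \<nu> * (W' c1 c2 s / W c1 c2 s))" for c1 c2
    by (simp add: velocity_formula_on_def W_def W'_def Let_def b_def k_def mult.assoc)
  show ?thesis
    unfolding formula b_def[symmetric]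
  proof
    assume eq: "\<forall>s\<in>{l..r}. du s = 1 / (2 * \<nu>) * (u s)\<^sup>2 + 2 * \<nu> * (a * s + b)"
    \<comment> \<open>Scaling \<open>W\<close> does not change the quotient, so \<open>W = 1\<close> at the left endpoint is a
      normalisation.\<close>
    obtain c1 c2 where "airy_comb c1 c2 (airy_arg a b l) = 1"
      "airy_comb' c1 c2 (airy_arg a b l) = - u l / (2 * \<nu> * k)"
      by (rule airy_comb_initial_values)
    then have init: "W c1 c2 l \<noteq> 0" "u l * W c1 c2 l = - 2 * \<nu> * W' c1 c2 l"
      using k assms(2) by (simp_all add: W_def W'_def)
    have "W c1 c2 s \<noteq> 0 \<and> u s = - 2 * \<nu> * (W' c1 c2 s / W c1 c2 s)" if "s \<in> {l..r}" for s
    proof (rule riccati_to_linear[where q = "\<lambda>s. a * s + b" and l = l and r = r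
          and u = u and W = "W c1 c2" and W' = "W' c1 c2"])
      show "(u has_real_derivative 1 / (2 * \<nu>) * (u s)\<^sup>2 + 2 * \<nu> * (a * s + b))
          (at s within {l..r})" if "s \<in> {l..r}" for s
        using u[OF that] eq that by simp
    qed (use assms(2) W W' init that in auto)
    then show "\<exists>c1 c2. \<forall>s\<in>{l..r}. W c1 c2 s \<noteq> 0 \<and> u s = - 2 * \<nu> * (W' c1 c2 s / W c1 c2 s)"
      by blast
  next
    assume "\<exists>c1 c2. \<forall>s\<in>{l..r}. W c1 c2 s \<noteq> 0 \<and> u s = - 2 * \<nu> * (W' c1 c2 s / W c1 c2 s)"
    then obtain c1 c2 where nz: "\<And>s. s \<in> {l..r} \<Longrightarrow> W c1 c2 s \<noteq> 0"
      and ueq: "\<And>s. s \<in> {l..r} \<Longrightarrow> u s = - 2 * \<nu> * (W' c1 c2 s / W c1 c2 s)"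
      by blast
    show "\<forall>s\<in>{l..r}. du s = 1 / (2 * \<nu>) * (u s)\<^sup>2 + 2 * \<nu> * (a * s + b)"
    proof
      fix s assume s: "s \<in> {l..r}"
      have "((\<lambda>s. - 2 * \<nu> * (W' c1 c2 s / W c1 c2 s)) has_real_derivative
          1 / (2 * \<nu>) * (u s)\<^sup>2 + 2 * \<nu> * (a * s + b)) (at s within {l..r})"
        unfolding ueq[OF s]
        by (rule linear_to_riccati[where q = "\<lambda>s. a * s + b"
              and W = "W c1 c2" and W' = "W' c1 c2"])
          (use assms(2) nz[OF s] W W' in auto)
      then have "(u has_real_derivative
          1 / (2 * \<nu>) * (u s)\<^sup>2 + 2 * \<nu> * (a * s + b)) (at s within {l..r})"
        by (rule has_field_derivative_transform_within[where d = 1]) (use s ueq in auto)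
      with u[OF s] show "du s = 1 / (2 * \<nu>) * (u s)\<^sup>2 + 2 * \<nu> * (a * s + b)"
        by (rule real_derivative_unique_Icc[OF assms(1) s])
    qed
  qed
qed

theorem mainTheorem1:
  fixes L \<nu> f1 K a :: real and u du ddu :: "real \<Rightarrow> real"
  assumes "L > 0" and "\<nu> > 0"
    and "a = 1 / (2 * \<nu>\<^sup>2) * (K - f1)" and "a < 0"
    and "\<And>s. s \<in> {0..L} \<Longrightarrow> (u has_real_derivative du s) (at s within {0..L})"
    and "\<And>s. s \<in> {0..L} \<Longrightarrow> (du has_real_derivative ddu s) (at s within {0..L})"
  shows "((\<forall>s\<in>{0..L}. u s * du s = f1 - K + \<nu> * ddu s) \<longleftrightarrow>
           (\<exists>c c1 c2. velocity_formula_on {0..L} \<nu> a c c1 c2 u)) \<and>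
         (\<forall>c. (\<forall>s\<in>{0..L}. du s = 1 / (2 * \<nu>) * (u s)\<^sup>2 + 1 / \<nu> * (K - f1) * s + c / \<nu>) \<longleftrightarrow>
           (\<exists>c1 c2. velocity_formula_on {0..L} \<nu> a c c1 c2 u))"
proof -
  have coeff: "1 / (2 * \<nu>) * (u s)\<^sup>2 + 1 / \<nu> * (K - f1) * s + c / \<nu>
      = 1 / (2 * \<nu>) * (u s)\<^sup>2 + 2 * \<nu> * (a * s + c / (2 * \<nu>\<^sup>2))" for s c
    using assms(2) unfolding assms(3) by (simp add: field_simps power2_eq_square)
  have riccati: "(\<forall>s\<in>{0..L}. du s = 1 / (2 * \<nu>) * (u s)\<^sup>2 + 1 / \<nu> * (K - f1) * s + c / \<nu>) \<longleftrightarrow>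
      (\<exists>c1 c2. velocity_formula_on {0..L} \<nu> a c c1 c2 u)" for c
    unfolding coeff
    by (rule riccati_iff_velocity_formula) (use assms in auto)
  have "(\<forall>s\<in>{0..L}. u s * du s = f1 - K + \<nu> * ddu s) \<longleftrightarrow>
      (\<exists>c. \<forall>s\<in>{0..L}. du s = 1 / (2 * \<nu>) * (u s)\<^sup>2 + 1 / \<nu> * (K - f1) * s + c / \<nu>)"
    using burgers_iff_riccati[of 0 L \<nu> u du ddu "K - f1"] assms by simp
  then show ?thesis
    using riccati by simp
qed

end
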